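(* Let $(u_n)_{n \geq 1}$ be a sequence of positive integers with $u_n \to +\infty$ as $n \to +\infty$, and let $k$ be a positive integer. Then for every nonzero integer $t$, the series below converges and $$\sum_{n = 1}^{+\infty} (-1)^{u_n} \frac{F_{u_{n+k} - u_n}}{F_{u_n} F_{u_{n+k}}} = \frac{1}{F_t}\left(\sum_{n=1}^{k} \frac{F_{u_n + t}}{F_{u_n}} - k\,\Phi^t\right).$$
   Context: $(F_n)_{n \in \mathbb{Z}}$ is the Fibonacci sequence: $F_0 = 0$, $F_1 = 1$, $F_{n+2} = F_{n+1} + F_n$ for all $n \in \mathbb{Z}$ (so that $F_{-n} = (-1)^{n+1} F_n$). $\Phi = \frac{1+\sqrt{5}}{2}$ is the golden ratio. *)

theory Defs
  imports Complex_Main "HOL-Number_Theory.Fib"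
begin

text \<open>
  The two-sided Fibonacci sequence, extending the library's \<^const>\<open>fib\<close> to all integers by
  $F_{-n} = (-1)^{n+1} F_n$. The lemmas below confirm that it is the sequence determined by
  the initial values 0, 1 and the Fibonacci recurrence on all of the integers.
\<close>

definition fibz :: "int \<Rightarrow> int" where
  "fibz n = (if n \<ge> 0 then int (fib (nat n)) else (-1) ^ (nat (-n) + 1) * int (fib (nat (-n))))"

definition golden :: real where
  "golden = (1 + sqrt 5) / 2"

lemma fibz_0: "fibz 0 = 0"
  by (simp add: fibz_def)

lemma fibz_1: "fibz 1 = 1"
  by (simp add: fibz_def)

lemma fibz_int: "fibz (int n) = int (fib n)"
  by (simp add: fibz_def)

lemma fibz_neg_int: "fibz (- int n) = (-1) ^ (n + 1) * int (fib n)"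
  by (cases "n = 0") (simp_all add: fibz_def)

lemma fibz_rec: "fibz (n + 2) = fibz (n + 1) + fibz n"
proof (cases "n \<ge> 0")
  case True
  then obtain m where "n = int m"
    using nonneg_int_cases by blast
  then have "n + 2 = int (m + 2)" "n + 1 = int (m + 1)" "n = int m"
    by simp_all
  then show ?thesis
    by (simp only: fibz_int) simp
next
  case False
  then obtain m where m: "n = - int (Suc m)"
    by (metis int_cases nonneg_int_cases zero_le_imp_eq_int of_nat_0_le_iff)
  show ?thesis
  proof (cases m)
    case 0
    then show ?thesis using m by (simp add: fibz_def)
  next
    case (Suc l)
    then have "n + 2 = - int l" "n + 1 = - int (Suc l)" "n = - int (Suc (Suc l))"
      using m by simp_all
    then show ?thesis
      by (simp only: fibz_neg_int) (simp add: algebra_simps)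
  qed
qed

lemma fibz_neg: "fibz (- int n) = (-1) ^ (n + 1) * fibz (int n)"
  by (simp add: fibz_neg_int fibz_int)

end

theory Submission
  imports Defs
begin

text \<open>
  Put $g_n = F_{u_n+t}/F_{u_n}$. D'Ocagne's identity turns the $n$-th term of the series into
  $(g_n - g_{n+k})/F_t$, so the series telescopes with step $k$; since $g_n \to \Phi^t$ by
  Binet's formula, the $k$ trailing terms of a partial sum contribute $-k\,\Phi^t$.
\<close>

text \<open>The step-\<open>k\<close> difference splits into \<open>k\<close> consecutive one-step
  differences. For each offset \<open>i < k\<close> these form an ordinary telescoping series with
  sum \<open>f i - L\<close>, and finitely many convergent series may be added.\<close>

lemma telescope_step_sums:
  fixes f :: "nat \<Rightarrow> 'a::real_normed_vector"
  assumes "f \<longlonglongrightarrow> L"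
  shows "(\<lambda>n. f n - f (n + k)) sums ((\<Sum>i<k. f i) - of_nat k *\<^sub>R L)"
proof -
  have "(\<lambda>n. f (n + i) - f (Suc n + i)) sums (f (0 + i) - L)" for i
    by (rule telescope_sums') (use assms in \<open>rule LIMSEQ_ignore_initial_segment\<close>)
  then have "(\<lambda>n. \<Sum>i<k. f (n + i) - f (Suc n + i)) sums (\<Sum>i<k. f (0 + i) - L)"
    by (intro sums_sum) blast
  moreover have "(\<Sum>i<k. f (n + i) - f (Suc n + i)) = f n - f (n + k)" for n
    using sum_lessThan_telescope'[of "\<lambda>i. f (n + i)" k] by simp
  ultimately show ?thesis
    by (simp add: sum_subtractf scaleR_conv_of_real sum_constant_scaleR)
qed

lemma golden_gt_1: "golden > 1"
  by (simp add: golden_def)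

text \<open>\<open>1 - golden\<close> stands for the conjugate root of x^2 = x + 1, whose two roots
  have product -1.\<close>

lemma golden_conj: "golden * (1 - golden) = -1"
  by (simp add: golden_def field_simps)

text \<open>The closed form for \<open>fib\<close> settles nonnegative indices. For negative ones,
  the inverse of each root is minus the other root, so the two powers trade places; this matches the
  sign in \<open>fibz_neg_int\<close>.\<close>

lemma fibz_Binet: "sqrt 5 * real_of_int (fibz n) = golden powi n - (1 - golden) powi n"
proof -
  have nat_case: "sqrt 5 * real (fib m) = golden ^ m - (1 - golden) ^ m" for m
    using fib_closed_form[of m] by (simp add: golden_def field_simps)
  show ?thesis
  proof (cases n rule: int_cases2)
    case (nonneg m)
    then show ?thesis
      using nat_case[of m] by (simp add: fibz_int)
  next
    case (nonpos m)
    have inv: "inverse golden = - (1 - golden)" "inverse (1 - golden) = - golden"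
      using golden_conj by (intro inverse_unique; simp add: algebra_simps)+
    have "sqrt 5 * real_of_int (fibz n) = (-1) ^ (m + 1) * (sqrt 5 * real (fib m))"
      by (simp add: nonpos fibz_neg_int)
    also have "\<dots> = (- (1 - golden)) ^ m - (- golden) ^ m"
      unfolding nat_case power_minus[of golden] power_minus[of "1 - golden"]
      by (simp add: algebra_simps)
    finally show ?thesis
      by (simp only: nonpos power_int_minus power_int_of_nat power_inverse[symmetric] inv)
  qed
qed

lemma fibz_eq_0_iff: "fibz n = 0 \<longleftrightarrow> n = 0"
  using fib_neq_0_nat[of "nat n"] fib_neq_0_nat[of "nat (- n)"] by (cases n "0::int" rule: linorder_cases) (auto simp: fibz_def)

lemma fibz_dOcagne:
  "fibz (int a + t) * fibz b - fibz (int a) * fibz (b + t)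
     = (-1) ^ a * fibz t * fibz (b - int a)"
proof -
  define x y where "x = golden" and "y = 1 - golden"
  have nz: "x \<noteq> 0" "y \<noteq> 0" and xy: "x * y = -1"
    using golden_gt_1 golden_conj by (auto simp: x_def y_def)
  define X Y where "X = x ^ a" and "Y = y ^ a"
  have XY: "X * Y = (-1) ^ a" and XYnz: "X \<noteq> 0" "Y \<noteq> 0"
    using nz by (simp_all add: X_def Y_def xy flip: power_mult_distrib)
  define p q r s where "p = x powi b" and "q = y powi b" and "r = x powi t" and "s = y powi t"
  note B = fibz_Binet[folded y_def, folded x_def]
  have "5 * real_of_int (fibz (int a + t) * fibz b - fibz (int a) * fibz (b + t))
      = (sqrt 5 * fibz (int a + t)) * (sqrt 5 * fibz b)
        - (sqrt 5 * fibz (int a)) * (sqrt 5 * fibz (b + t))"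
    by (simp add: algebra_simps)
  also have "\<dots> = (X * r - Y * s) * (p - q) - (X - Y) * (p * r - q * s)"
    unfolding B using nz by (simp add: power_int_add X_def Y_def p_def q_def r_def s_def)
  \<comment> \<open>The unmixed products \<open>X * r * p\<close> and \<open>Y * s * q\<close>
    cancel; the four mixed ones factor.\<close>
  also have "\<dots> = (r - s) * (Y * p - X * q)"
    by (simp add: algebra_simps)
  \<comment> \<open>Pulling out \<open>X * Y\<close> produces the sign \<open>(-1) ^ a\<close> and
    leaves quotients that are powers with exponent \<open>b - int a\<close>, ready for Binet in
    reverse.\<close>
  also have "\<dots> = (X * Y) * (r - s) * (p / X - q / Y)"
    using XYnz by (simp add: field_simps)
  also have "\<dots> = (-1) ^ a * (sqrt 5 * fibz t) * (sqrt 5 * fibz (b - int a))"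
    unfolding B using nz
    by (simp add: power_int_diff XY) (simp add: X_def Y_def p_def q_def r_def s_def)
  also have "\<dots> = 5 * real_of_int ((-1) ^ a * fibz t * fibz (b - int a))"
    by (simp add: algebra_simps)
  finally show ?thesis
    by (simp only: mult_cancel_left of_int_eq_iff) simp
qed

text \<open>Dividing both Binet expressions by \<open>golden ^ n\<close> leaves only powers of
  \<open>q = (1 - golden) / golden\<close>, which vanish in the limit since
  \<open>\<bar>q\<bar> < 1\<close>.\<close>

lemma fibz_ratio_tendsto:
  "(\<lambda>n. real_of_int (fibz (int n + t)) / real_of_int (fibz (int n))) \<longlonglongrightarrow> golden powi t"
proof -
  define y where "y = 1 - golden"
  define q where "q = y / golden"
  have g: "golden > 1" and y: "y \<noteq> 0"
    using golden_gt_1 by (auto simp: y_def)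
  have "\<bar>q\<bar> < 1"
    using g by (simp add: q_def y_def abs_if field_simps)
  then have q: "(\<lambda>n. q ^ n) \<longlonglongrightarrow> 0"
    by (intro LIMSEQ_power_zero) simp
  have "(\<lambda>n. (golden powi t - q ^ n * y powi t) / (1 - q ^ n))
          \<longlonglongrightarrow> (golden powi t - 0 * y powi t) / (1 - 0)"
    by (intro tendsto_intros q) simp
  \<comment> \<open>This includes \<open>n = 0\<close>: both denominators are then 0, so both
    quotients are 0 by convention.\<close>
  moreover have "real_of_int (fibz (int n + t)) / real_of_int (fibz (int n))
      = (golden powi t - q ^ n * y powi t) / (1 - q ^ n)" for n
  proof -
    have "real_of_int (fibz (int n + t)) / real_of_int (fibz (int n))
        = (sqrt 5 * fibz (int n + t)) / (sqrt 5 * fibz (int n))"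
      by simp
    also have "\<dots> = (golden ^ n * golden powi t - y ^ n * y powi t) / (golden ^ n - y ^ n)"
      unfolding fibz_Binet using g y by (simp add: power_int_add flip: y_def)
    also have "\<dots> = (golden ^ n * (golden powi t - q ^ n * y powi t)) / (golden ^ n * (1 - q ^ n))"
      using g by (simp add: q_def power_divide right_diff_distrib)
    also have "\<dots> = (golden powi t - q ^ n * y powi t) / (1 - q ^ n)"
      using g by simp
    finally show ?thesis .
  qed
  ultimately show ?thesis
    by simp
qed

theorem theorem2p1:
  fixes u :: "nat \<Rightarrow> nat" and k :: nat and t :: int
  assumes u_pos: "\<And>n. n \<ge> 1 \<Longrightarrow> u n > 0"
    and u_lim: "filterlim u at_top sequentially"
    and k_pos: "k > 0"
    and t_nz: "t \<noteq> 0"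
  shows "(\<lambda>m. let n = m + 1 in
            (-1) ^ u n * real_of_int (fibz (int (u (n + k)) - int (u n)))
              / (real_of_int (fibz (int (u n))) * real_of_int (fibz (int (u (n + k))))))
         sums
         (1 / real_of_int (fibz t)
            * ((\<Sum>n=1..k. real_of_int (fibz (int (u n) + t)) / real_of_int (fibz (int (u n))))
               - real k * golden powi t))"
proof -
  define g where "g n = real_of_int (fibz (int (u n) + t)) / real_of_int (fibz (int (u n)))" for n
  have "g \<longlonglongrightarrow> golden powi t"
    unfolding g_def by (rule filterlim_compose[OF fibz_ratio_tendsto u_lim])
  \<comment> \<open>The series starts at \<open>n = 1\<close>, so the sequence is shifted before
    telescoping: the leading terms become \<open>g 1, ..., g k\<close>, and \<open>u 0\<close>,
    which may be 0, stays out.\<close>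
  then have "(\<lambda>m. g (m + 1)) \<longlonglongrightarrow> golden powi t"
    by (rule LIMSEQ_ignore_initial_segment)
  from sums_mult[OF telescope_step_sums[OF this, of k], of "1 / real_of_int (fibz t)"]
  have sums: "(\<lambda>m. 1 / real_of_int (fibz t) * (g (m + 1) - g (m + 1 + k)))
      sums (1 / real_of_int (fibz t) * ((\<Sum>n=1..k. g n) - real k * golden powi t))"
    by (simp add: sum.atLeast1_atMost_eq)
  \<comment> \<open>Over a common denominator the numerator is the left side of
    \<open>fibz_dOcagne\<close> with \<open>a = u n\<close> and \<open>b = int (u (n + k))\<close>;
    its factor \<open>fibz t\<close> cancels the prefactor.\<close>
  have eq: "1 / real_of_int (fibz t) * (g n - g (n + k))
      = (-1) ^ u n * real_of_int (fibz (int (u (n + k)) - int (u n)))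
          / (real_of_int (fibz (int (u n))) * real_of_int (fibz (int (u (n + k)))))"
    if "n \<ge> 1" for n
  proof -
    have nz: "fibz (int (u n)) \<noteq> 0" "fibz (int (u (n + k))) \<noteq> 0" "fibz t \<noteq> 0"
      using u_pos[of n] u_pos[of "n + k"] that t_nz by (auto simp: fibz_eq_0_iff)
    have "g n - g (n + k)
        = real_of_int (fibz (int (u n) + t) * fibz (int (u (n + k)))
                       - fibz (int (u n)) * fibz (int (u (n + k)) + t))
          / (real_of_int (fibz (int (u n))) * real_of_int (fibz (int (u (n + k)))))"
      using nz by (simp add: g_def field_simps)
    then show ?thesis
      using nz by (simp add: fibz_dOcagne)
  qed
  show ?thesis
    using sums by (simp only: Let_def eq le_add2 flip: g_def)
qed

end
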